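(* Let $0<\alpha<1$, $0<\beta<1$, and let $(Y_t)_{t\in\mathbb N}$ be the $\{-1,1\}$-valued Markov chain with transition matrix $\begin{pmatrix}1-\alpha&\alpha\\\beta&1-\beta\end{pmatrix}$ (rows and columns ordered as $-1,1$), and $X_t=\sum_{i=0}^tY_i$. For $\lambda>0$ and $t\in\mathbb N$ let $\Phi(\lambda,t)=\mathbb E[\lambda^{X_t}]$. Then $$\Phi(\lambda,t)=a_+\theta_+^t+a_-\theta_-^t,$$ where $$a_+=\frac{1-\alpha+\lambda(\lambda\alpha-\theta_-)}{\lambda^2\sqrt{\mathcal D}}\quad\text{and}\quad a_-=\frac1\lambda-a_+\qquad\text{if } X_0=Y_0=-1,$$ and $$a_+=\frac{(1-\beta)\lambda^2+\beta-\lambda\theta_-}{\sqrt{\mathcal D}}\quad\text{and}\quad a_-=\lambda-a_+\qquad\text{if } X_0=Y_0=1.$$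
   Context: Here $$\mathcal D=\Big(\frac{1-\alpha}\lambda+(1-\beta)\lambda\Big)^2-4(1-\alpha-\beta)$$ (which is positive for every $\lambda>0$) and $$\theta_\pm=\frac12\Big(\frac{1-\alpha}\lambda+(1-\beta)\lambda\pm\sqrt{\mathcal D}\Big).$$ The convention $\theta^0=1$ is used (also for $\theta=0$). *)

theory Defs
  imports "HOL-Probability.Probability"
begin

definition stochastic_matrix :: "'s set \<Rightarrow> ('s \<Rightarrow> 's \<Rightarrow> real) \<Rightarrow> bool" where
  "stochastic_matrix S p \<longleftrightarrow>
     (\<forall>x\<in>S. (\<forall>y\<in>S. 0 \<le> p x y) \<and> (p x has_sum 1) S)"

text \<open>
  Time-homogeneous Markov chain, defined on the probability space \<open>M\<close>, with countable state
  space \<open>S\<close> and transition matrix \<open>p\<close>. The initial distribution is left unspecified. Membership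
  in \<open>measurable M (count_space S)\<close> says both that \<open>Y t\<close> is \<open>S\<close>-valued and that it is a random
  variable. The Markov property is required only for histories of positive probability, as
  \<open>cond_prob\<close> is \<open>0\<close> when conditioning on a null event.
\<close>
definition markov_chain ::
  "'a measure \<Rightarrow> 's set \<Rightarrow> ('s \<Rightarrow> 's \<Rightarrow> real) \<Rightarrow> (nat \<Rightarrow> 'a \<Rightarrow> 's) \<Rightarrow> bool" where
  "markov_chain M S p Y \<longleftrightarrow>
     prob_space M \<and> countable S \<and> stochastic_matrix S p \<and>
     (\<forall>t. Y t \<in> measurable M (count_space S)) \<and>
     (\<forall>t y. (\<forall>i\<le>Suc t. y i \<in> S) \<longrightarrow>
        \<P>(\<omega> in M. \<forall>i\<le>t. Y i \<omega> = y i) > 0 \<longrightarrow>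
        \<P>(\<omega> in M. Y (Suc t) \<omega> = y (Suc t) \<bar> \<forall>i\<le>t. Y i \<omega> = y i) = p (y t) (y (Suc t)))"

text \<open>Meaningful for arguments in \<open>{-1, 1}\<close> only.\<close>
definition two_state_matrix :: "real \<Rightarrow> real \<Rightarrow> int \<Rightarrow> int \<Rightarrow> real" where
  "two_state_matrix \<alpha> \<beta> x y =
     (if x = -1 then (if y = -1 then 1 - \<alpha> else \<alpha>)
      else (if y = -1 then \<beta> else 1 - \<beta>))"

definition partial_sum :: "(nat \<Rightarrow> 'a \<Rightarrow> int) \<Rightarrow> nat \<Rightarrow> 'a \<Rightarrow> int" where
  "partial_sum Y t \<omega> = (\<Sum>i=0..t. Y i \<omega>)"

definition Phi :: "'a measure \<Rightarrow> (nat \<Rightarrow> 'a \<Rightarrow> int) \<Rightarrow> real \<Rightarrow> nat \<Rightarrow> real" where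
  "Phi M Y lam t = (\<integral>\<omega>. lam powi (partial_sum Y t \<omega>) \<partial>M)"

definition discr :: "real \<Rightarrow> real \<Rightarrow> real \<Rightarrow> real" where
  "discr \<alpha> \<beta> lam = ((1 - \<alpha>) / lam + (1 - \<beta>) * lam)\<^sup>2 - 4 * (1 - \<alpha> - \<beta>)"

definition theta_plus :: "real \<Rightarrow> real \<Rightarrow> real \<Rightarrow> real" where
  "theta_plus \<alpha> \<beta> lam =
     1 / 2 * ((1 - \<alpha>) / lam + (1 - \<beta>) * lam + sqrt (discr \<alpha> \<beta> lam))"

definition theta_minus :: "real \<Rightarrow> real \<Rightarrow> real \<Rightarrow> real" where
  "theta_minus \<alpha> \<beta> lam =
     1 / 2 * ((1 - \<alpha>) / lam + (1 - \<beta>) * lam - sqrt (discr \<alpha> \<beta> lam))"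

lemma stochastic_two_state_matrix:
  assumes "0 < \<alpha>" "\<alpha> < 1" "0 < \<beta>" "\<beta> < 1"
  shows "stochastic_matrix {-1, 1} (two_state_matrix \<alpha> \<beta>)"
  using assms by (auto simp: stochastic_matrix_def two_state_matrix_def intro!: has_sum_finiteI)

lemma discr_pos:
  assumes "0 < \<alpha>" "0 < \<beta>" "0 < lam"
  shows "discr \<alpha> \<beta> lam > 0"
proof -
  have "discr \<alpha> \<beta> lam = ((1 - \<alpha>) / lam - (1 - \<beta>) * lam)\<^sup>2 + 4 * (\<alpha> * \<beta>)"
    using assms by (simp add: discr_def power2_eq_square field_simps)
  then show ?thesis
    using assms by (simp add: add_nonneg_pos)
qed

end

theory Submission
  imports Defs
begin

text \<open>
  Weighting each step into a state \<open>y\<close> by \<open>lam powi y\<close> turns the transition matrix into the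
  tilted matrix \<open>Q x y = p x y * lam powi y\<close>. The Markov property gives, for every function \<open>g\<close>
  of the current state,
  \<open>E (lam powi X (t + 1) * g (Y (t + 1))) = E (lam powi X t * (Q g) (Y t))\<close>
  (lemma \<open>tilted_step\<close>). Hence \<open>Phi (t + k) = E (lam powi X t * (Q ^ k 1) (Y t))\<close>. As \<open>Q\<close> is a
  2 by 2 matrix, Cayley--Hamilton gives \<open>Q ^ 2 = tr Q * Q - det Q\<close> (lemma
  \<open>tilted_op_Cayley_Hamilton\<close>), so \<open>Phi\<close> satisfies the linear recurrence of order two whose
  characteristic polynomial is that of \<open>Q\<close>. Its roots are \<open>theta_plus\<close> and \<open>theta_minus\<close>: their sum
  is \<open>tr Q\<close> and their product is \<open>det Q = 1 - \<alpha> - \<beta>\<close>. They are distinct because the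
  discriminant is positive, so the recurrence is solved by
  \<open>a * theta_plus ^ t + (Phi 0 - a) * theta_minus ^ t\<close>, and \<open>a\<close> is read off from \<open>Phi 0\<close> and
  \<open>Phi 1\<close>. Only these two values depend on the starting state.
\<close>

section \<open>The Markov property for functionals of the history\<close>

definition history :: "(nat \<Rightarrow> 'a \<Rightarrow> 's) \<Rightarrow> nat \<Rightarrow> 'a \<Rightarrow> nat \<Rightarrow> 's" where
  "history Y t \<omega> = restrict (\<lambda>i. Y i \<omega>) {..t}"

definition cylinder :: "'a measure \<Rightarrow> (nat \<Rightarrow> 'a \<Rightarrow> 's) \<Rightarrow> nat \<Rightarrow> (nat \<Rightarrow> 's) \<Rightarrow> 'a set" where
  "cylinder M Y t h = {\<omega> \<in> space M. \<forall>i\<le>t. Y i \<omega> = h i}"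

lemma markov_chain_in_state_space:
  assumes "markov_chain M S p Y" "\<omega> \<in> space M"
  shows "Y t \<omega> \<in> S"
  using assms unfolding markov_chain_def by (metis measurable_space space_count_space)

lemma sets_state_event:
  assumes "markov_chain M S p Y"
  shows "{\<omega> \<in> space M. Y t \<omega> = y} \<in> sets M"
proof -
  have "Y t \<in> measurable M (count_space S)"
    using assms by (simp add: markov_chain_def)
  then have "Y t -` ({y} \<inter> S) \<inter> space M \<in> sets M"
    by (rule measurable_sets) auto
  moreover have "{\<omega> \<in> space M. Y t \<omega> = y} = Y t -` ({y} \<inter> S) \<inter> space M"
    using markov_chain_in_state_space[OF assms] by auto
  ultimately show ?thesis by simp
qed

lemma sets_cylinder:
  assumes "markov_chain M S p Y"
  shows "cylinder M Y t h \<in> sets M"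
proof -
  have "cylinder M Y t h = (\<Inter>i\<in>{..t}. {\<omega> \<in> space M. Y i \<omega> = h i})"
    by (auto simp: cylinder_def)
  also have "\<dots> \<in> sets M"
    by (intro sets.finite_INT) (auto intro: sets_state_event[OF assms])
  finally show ?thesis .
qed

text \<open>
  The product form of the Markov property. Unlike the conditional one it also holds for histories
  of probability zero, because then both sides vanish.
\<close>
lemma prob_cylinder_step:
  assumes mc: "markov_chain M S p Y" and h: "\<And>i. i \<le> t \<Longrightarrow> h i \<in> S" and y: "y \<in> S"
  shows "measure M (cylinder M Y t h \<inter> {\<omega> \<in> space M. Y (Suc t) \<omega> = y})
    = measure M (cylinder M Y t h) * p (h t) y"
proof -
  interpret prob_space M using mc by (simp add: markov_chain_def)
  let ?A = "cylinder M Y t h" and ?B = "{\<omega> \<in> space M. Y (Suc t) \<omega> = y}"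
  define h' where "h' = h(Suc t := y)"
  have A: "?A = {\<omega> \<in> space M. \<forall>i\<le>t. Y i \<omega> = h' i}"
    by (auto simp: cylinder_def h'_def)
  show ?thesis
  proof (cases "measure M ?A = 0")
    case True
    moreover have "measure M (?A \<inter> ?B) \<le> measure M ?A"
      by (intro finite_measure_mono sets_cylinder[OF mc]) auto
    ultimately show ?thesis
      by (simp add: measure_le_0_iff)
  next
    case False
    then have pos: "\<P>(\<omega> in M. \<forall>i\<le>t. Y i \<omega> = h' i) > 0"
      by (simp add: A zero_less_measure_iff)
    have "\<forall>i\<le>Suc t. h' i \<in> S"
      using h y by (auto simp: h'_def)
    then have "\<P>(\<omega> in M. Y (Suc t) \<omega> = h' (Suc t) \<bar> \<forall>i\<le>t. Y i \<omega> = h' i) = p (h' t) (h' (Suc t))"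
      using mc pos by (simp add: markov_chain_def)
    moreover have "{\<omega> \<in> space M. Y (Suc t) \<omega> = h' (Suc t) \<and> (\<forall>i\<le>t. Y i \<omega> = h' i)} = ?A \<inter> ?B"
      by (auto simp: A h'_def)
    ultimately have "measure M (?A \<inter> ?B) / measure M ?A = p (h t) y"
      by (simp add: cond_prob_def A h'_def)
    then show ?thesis
      using False by (simp add: field_simps)
  qed
qed

text \<open>
  With finitely many states only finitely many histories of a given length are possible. Every
  functional of the history is therefore a simple function, and its expectation a finite sum.
\<close>
lemma history_decomposition:
  assumes mc: "markov_chain M S p Y" and S: "finite S" and \<omega>: "\<omega> \<in> space M"
  shows "F (history Y t \<omega>)
    = (\<Sum>h\<in>PiE {..t} (\<lambda>_. S). F h * indicator (cylinder M Y t h) \<omega> :: real)"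
proof -
  let ?H = "PiE {..t} (\<lambda>_. S)"
  have mem: "history Y t \<omega> \<in> ?H"
    using markov_chain_in_state_space[OF mc \<omega>] by (auto simp: history_def)
  have ind: "indicator (cylinder M Y t h) \<omega> = (if h = history Y t \<omega> then 1 else 0 :: real)"
    if "h \<in> ?H" for h
  proof -
    have "\<omega> \<in> cylinder M Y t h \<longleftrightarrow> h = history Y t \<omega>"
    proof
      assume "\<omega> \<in> cylinder M Y t h"
      then have "h i = history Y t \<omega> i" if "i \<in> {..t}" for i
        using that by (simp add: cylinder_def history_def)
      then show "h = history Y t \<omega>"
        using PiE_ext[OF \<open>h \<in> ?H\<close> mem] by blast
    qed (use \<omega> in \<open>auto simp: cylinder_def history_def\<close>)
    then show ?thesis by (simp add: indicator_def)
  qed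
  have "(\<Sum>h\<in>?H. F h * indicator (cylinder M Y t h) \<omega>)
      = (\<Sum>h\<in>?H. if h = history Y t \<omega> then F h else 0)"
    by (intro sum.cong refl) (simp add: ind)
  also have "\<dots> = F (history Y t \<omega>)"
    using mem S by (simp add: finite_PiE)
  finally show ?thesis by simp
qed

lemma expectation_history:
  assumes mc: "markov_chain M S p Y" and S: "finite S"
  shows "(\<integral>\<omega>. F (history Y t \<omega>) \<partial>M)
    = (\<Sum>h\<in>PiE {..t} (\<lambda>_. S). F h * measure M (cylinder M Y t h) :: real)"
proof -
  interpret prob_space M using mc by (simp add: markov_chain_def)
  note [simp] = sets_cylinder[OF mc]
  have "(\<integral>\<omega>. F (history Y t \<omega>) \<partial>M)
      = (\<integral>\<omega>. (\<Sum>h\<in>PiE {..t} (\<lambda>_. S). F h * indicator (cylinder M Y t h) \<omega>) \<partial>M)"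
    by (intro Bochner_Integration.integral_cong refl history_decomposition[OF mc S])
  also have "\<dots> = (\<Sum>h\<in>PiE {..t} (\<lambda>_. S). F h * measure M (cylinder M Y t h))"
    by (subst Bochner_Integration.integral_sum)
       (auto simp: Int_absorb2 sets.sets_into_space less_top[symmetric]
         intro!: integrable_mult_right integrable_real_indicator)
  finally show ?thesis .
qed

text \<open>
  Given the history up to time \<open>t\<close>, the next state may be averaged out with the row of \<open>p\<close>
  belonging to the current state.
\<close>
lemma expectation_history_step:
  fixes g :: "'s \<Rightarrow> real"
  assumes mc: "markov_chain M S p Y" and S: "finite S"
  shows "(\<integral>\<omega>. F (history Y t \<omega>) * g (Y (Suc t) \<omega>) \<partial>M)
    = (\<integral>\<omega>. F (history Y t \<omega>) * (\<Sum>y\<in>S. p (Y t \<omega>) y * g y) \<partial>M)"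
proof -
  interpret prob_space M using mc by (simp add: markov_chain_def)
  let ?H = "PiE {..t} (\<lambda>_. S)"
  let ?A = "cylinder M Y t" and ?B = "\<lambda>y. {\<omega> \<in> space M. Y (Suc t) \<omega> = y}"
  have sets: "?A h \<inter> ?B y \<in> sets M" for h y
    by (intro sets.Int sets_cylinder[OF mc] sets_state_event[OF mc])
  have int: "integrable M (\<lambda>\<omega>. c * indicator (?A h \<inter> ?B y) \<omega> :: real)" for c h y
    by (intro integrable_mult_right integrable_real_indicator sets)
       (simp add: less_top[symmetric])
  have intgl: "(\<integral>\<omega>. c * indicator (?A h \<inter> ?B y) \<omega> \<partial>M) = c * measure M (?A h \<inter> ?B y)"
    for c :: real and h y
    using sets[of h y] by (simp add: Int_absorb2 sets.sets_into_space)
  have "F (history Y t \<omega>) * g (Y (Suc t) \<omega>)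
      = (\<Sum>h\<in>?H. \<Sum>y\<in>S. F h * g y * indicator (?A h \<inter> ?B y) \<omega>)" if \<omega>: "\<omega> \<in> space M" for \<omega>
  proof -
    have "g (Y (Suc t) \<omega>) = (\<Sum>y\<in>S. g y * indicator (?B y) \<omega>)"
      using markov_chain_in_state_space[OF mc \<omega>, of "Suc t"] S \<omega>
      by (simp add: indicator_def if_distrib cong: if_cong)
    then show ?thesis
      unfolding history_decomposition[OF mc S \<omega>, of F t]
      by (simp add: sum_product indicator_inter_arith mult_ac)
  qed
  then have "(\<integral>\<omega>. F (history Y t \<omega>) * g (Y (Suc t) \<omega>) \<partial>M)
      = (\<integral>\<omega>. (\<Sum>h\<in>?H. \<Sum>y\<in>S. F h * g y * indicator (?A h \<inter> ?B y) \<omega>) \<partial>M)"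
    by (intro Bochner_Integration.integral_cong refl)
  also have "\<dots> = (\<Sum>h\<in>?H. \<integral>\<omega>. (\<Sum>y\<in>S. F h * g y * indicator (?A h \<inter> ?B y) \<omega>) \<partial>M)"
    by (intro Bochner_Integration.integral_sum Bochner_Integration.integrable_sum int)
  also have "\<dots> = (\<Sum>h\<in>?H. \<Sum>y\<in>S. \<integral>\<omega>. F h * g y * indicator (?A h \<inter> ?B y) \<omega> \<partial>M)"
    by (intro sum.cong refl Bochner_Integration.integral_sum int)
  also have "\<dots> = (\<Sum>h\<in>?H. \<Sum>y\<in>S. F h * g y * measure M (?A h \<inter> ?B y))"
    by (simp only: intgl)
  also have "\<dots> = (\<Sum>h\<in>?H. \<Sum>y\<in>S. F h * g y * (measure M (?A h) * p (h t) y))"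
    by (intro sum.cong refl arg_cong2[where f = "(*)"] prob_cylinder_step[OF mc]) auto
  also have "\<dots> = (\<Sum>h\<in>?H. F h * (\<Sum>y\<in>S. p (h t) y * g y) * measure M (?A h))"
    by (simp add: sum_distrib_left sum_distrib_right mult_ac)
  also have "\<dots> = (\<integral>\<omega>. F (history Y t \<omega>) * (\<Sum>y\<in>S. p (history Y t \<omega> t) y * g y) \<partial>M)"
    by (rule expectation_history[OF mc S, symmetric])
  finally show ?thesis
    by (simp add: history_def)
qed

section \<open>The tilted transition operator\<close>

definition tilted_op ::
  "(int \<Rightarrow> int \<Rightarrow> real) \<Rightarrow> int set \<Rightarrow> real \<Rightarrow> (int \<Rightarrow> real) \<Rightarrow> int \<Rightarrow> real" where
  "tilted_op p S lam g x = (\<Sum>y\<in>S. p x y * (lam powi y * g y))"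

lemma tilted_step:
  fixes Y :: "nat \<Rightarrow> 'a \<Rightarrow> int"
  assumes mc: "markov_chain M S p Y" and S: "finite S" and lam: "lam \<noteq> 0"
  shows "(\<integral>\<omega>. lam powi partial_sum Y (Suc t) \<omega> * g (Y (Suc t) \<omega>) \<partial>M)
    = (\<integral>\<omega>. lam powi partial_sum Y t \<omega> * tilted_op p S lam g (Y t \<omega>) \<partial>M)"
proof -
  have hist: "partial_sum Y t \<omega> = (\<Sum>i\<le>t. history Y t \<omega> i)" for \<omega>
    by (simp add: partial_sum_def history_def atLeast0AtMost)
  have "lam powi partial_sum Y (Suc t) \<omega> = lam powi partial_sum Y t \<omega> * lam powi Y (Suc t) \<omega>" for \<omega>
    using lam by (simp add: partial_sum_def power_int_add)
  then show ?thesis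
    unfolding tilted_op_def hist
    using expectation_history_step[OF mc S, of "\<lambda>h. lam powi (\<Sum>i\<le>t. h i)" t "\<lambda>y. lam powi y * g y"]
    by (simp add: mult.assoc)
qed

lemma integrable_tilted:
  fixes Y :: "nat \<Rightarrow> 'a \<Rightarrow> int" and g :: "int \<Rightarrow> real"
  assumes mc: "markov_chain M S p Y" and S: "finite S"
  shows "integrable M (\<lambda>\<omega>. lam powi partial_sum Y t \<omega> * g (Y t \<omega>))"
proof -
  interpret prob_space M using mc by (simp add: markov_chain_def)
  let ?F = "\<lambda>h :: nat \<Rightarrow> int. lam powi (\<Sum>i\<le>t. h i) * g (h t)"
  have "integrable M (\<lambda>\<omega>. \<Sum>h\<in>PiE {..t} (\<lambda>_. S). ?F h * indicator (cylinder M Y t h) \<omega>)"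
    by (intro Bochner_Integration.integrable_sum integrable_mult_right
        integrable_real_indicator sets_cylinder[OF mc]) (simp add: less_top[symmetric])
  also have "?this \<longleftrightarrow> integrable M (\<lambda>\<omega>. ?F (history Y t \<omega>))"
    by (intro Bochner_Integration.integrable_cong refl history_decomposition[OF mc S, symmetric])
  finally show ?thesis
    by (simp add: history_def partial_sum_def atLeast0AtMost)
qed

lemma tilted_op_two_state:
  "tilted_op (two_state_matrix \<alpha> \<beta>) {-1, 1} lam g x
    = (if x = -1 then (1 - \<alpha>) * (g (-1) / lam) + \<alpha> * (lam * g 1)
       else \<beta> * (g (-1) / lam) + (1 - \<beta>) * (lam * g 1))"
  by (simp add: tilted_op_def two_state_matrix_def power_int_minus divide_inverse)

text \<open>
  The two coefficients are the trace and the determinant of the tilted matrix. The tilting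
  multiplies the columns by \<open>1 / lam\<close> and \<open>lam\<close>, so it does not change the determinant.
\<close>
lemma tilted_op_Cayley_Hamilton:
  fixes \<alpha> \<beta> lam :: real
  assumes "lam \<noteq> 0" and "x \<in> {-1, 1}"
  defines "Q \<equiv> tilted_op (two_state_matrix \<alpha> \<beta>) {-1, 1} lam"
  shows "Q (Q g) x = ((1 - \<alpha>) / lam + (1 - \<beta>) * lam) * Q g x - (1 - \<alpha> - \<beta>) * g x"
  using assms(1,2) unfolding Q_def tilted_op_two_state
  by (auto simp: field_simps)

section \<open>The recurrence and its solution\<close>

lemma theta_sum: "theta_plus \<alpha> \<beta> lam + theta_minus \<alpha> \<beta> lam = (1 - \<alpha>) / lam + (1 - \<beta>) * lam"
  by (simp add: theta_plus_def theta_minus_def algebra_simps)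

lemma theta_diff: "theta_plus \<alpha> \<beta> lam - theta_minus \<alpha> \<beta> lam = sqrt (discr \<alpha> \<beta> lam)"
  by (simp add: theta_plus_def theta_minus_def algebra_simps)

lemma theta_prod:
  assumes "discr \<alpha> \<beta> lam \<ge> 0"
  shows "theta_plus \<alpha> \<beta> lam * theta_minus \<alpha> \<beta> lam = 1 - \<alpha> - \<beta>"
proof -
  let ?s = "(1 - \<alpha>) / lam + (1 - \<beta>) * lam"
  have "1 / 2 * (s + d) * (1 / 2 * (s - d)) = (s\<^sup>2 - d\<^sup>2) / 4" for s d :: real
    by (simp add: power2_eq_square field_simps)
  then have "theta_plus \<alpha> \<beta> lam * theta_minus \<alpha> \<beta> lam = (?s\<^sup>2 - (sqrt (discr \<alpha> \<beta> lam))\<^sup>2) / 4"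
    unfolding theta_plus_def theta_minus_def .
  then show ?thesis
    using assms by (simp add: discr_def)
qed

lemma Phi_eq_tilted:
  assumes "markov_chain M S p Y" "finite S" "lam \<noteq> 0"
  shows "Phi M Y lam (Suc t)
    = (\<integral>\<omega>. lam powi partial_sum Y t \<omega> * tilted_op p S lam (\<lambda>_. 1) (Y t \<omega>) \<partial>M)"
  using tilted_step[OF assms, of t "\<lambda>_. 1"] by (simp add: Phi_def)

lemma Phi_recurrence:
  assumes mc: "markov_chain M {-1, 1} (two_state_matrix \<alpha> \<beta>) Y" and lam: "lam \<noteq> 0"
  shows "Phi M Y lam (Suc (Suc t))
    = ((1 - \<alpha>) / lam + (1 - \<beta>) * lam) * Phi M Y lam (Suc t) - (1 - \<alpha> - \<beta>) * Phi M Y lam t"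
proof -
  let ?Q = "tilted_op (two_state_matrix \<alpha> \<beta>) {-1, 1} lam"
  let ?tr = "(1 - \<alpha>) / lam + (1 - \<beta>) * lam" and ?det = "1 - \<alpha> - \<beta>"
  let ?L = "\<lambda>\<omega>. lam powi partial_sum Y t \<omega>"
  have fin: "finite {-1, 1 :: int}" by simp
  have "Phi M Y lam (Suc (Suc t)) = (\<integral>\<omega>. ?L \<omega> * ?Q (?Q (\<lambda>_. 1)) (Y t \<omega>) \<partial>M)"
    by (simp only: Phi_eq_tilted[OF mc fin lam] tilted_step[OF mc fin lam])
  also have "\<dots> = (\<integral>\<omega>. ?tr * (?L \<omega> * ?Q (\<lambda>_. 1) (Y t \<omega>)) - ?det * (?L \<omega> * 1) \<partial>M)"
    by (intro Bochner_Integration.integral_cong refl,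
        subst tilted_op_Cayley_Hamilton[OF lam markov_chain_in_state_space[OF mc]])
       (simp_all add: algebra_simps)
  also have "\<dots> = ?tr * (\<integral>\<omega>. ?L \<omega> * ?Q (\<lambda>_. 1) (Y t \<omega>) \<partial>M) - ?det * (\<integral>\<omega>. ?L \<omega> * 1 \<partial>M)"
    using integrable_tilted[OF mc fin, of lam t "?Q (\<lambda>_. 1)"]
      integrable_tilted[OF mc fin, of lam t "\<lambda>_. 1"]
    by (subst Bochner_Integration.integral_diff) (auto simp del: mult_1_right)
  also have "\<dots> = ?tr * Phi M Y lam (Suc t) - ?det * Phi M Y lam t"
    by (simp add: Phi_eq_tilted[OF mc fin lam]) (simp add: Phi_def)
  finally show ?thesis .
qed

lemma second_order_recurrence_solution:
  fixes x :: "nat \<Rightarrow> 'a :: field"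
  assumes rec: "\<And>n. x (Suc (Suc n)) = (p + q) * x (Suc n) - p * q * x n"
    and neq: "p \<noteq> q" and a: "a = (x 1 - q * x 0) / (p - q)"
  shows "x n = a * p ^ n + (x 0 - a) * q ^ n"
proof (induction n rule: less_induct)
  case (less n)
  consider "n = 0" | "n = 1" | m where "n = Suc (Suc m)"
    by (metis One_nat_def not0_implies_Suc)
  then show ?case
  proof cases
    case 2
    have "a * (p - q) = x 1 - q * x 0"
      using a neq by simp
    then show ?thesis
      using 2 by (simp add: algebra_simps)
  next
    case 3
    have "x (Suc m) = a * p ^ Suc m + (x 0 - a) * q ^ Suc m" "x m = a * p ^ m + (x 0 - a) * q ^ m"
      using less.IH[of "Suc m"] less.IH[of m] 3 by auto
    then have "x n = (p + q) * (a * p ^ Suc m + (x 0 - a) * q ^ Suc m)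
        - p * q * (a * p ^ m + (x 0 - a) * q ^ m)"
      using rec[of m] by (simp only: 3)
    then show ?thesis
      by (simp add: 3 algebra_simps)
  qed simp
qed

lemma Phi_closed_form:
  assumes mc: "markov_chain M {-1, 1} (two_state_matrix \<alpha> \<beta>) Y" and lam: "lam \<noteq> 0"
    and D: "discr \<alpha> \<beta> lam > 0"
    and a: "a = (Phi M Y lam 1 - theta_minus \<alpha> \<beta> lam * Phi M Y lam 0) / sqrt (discr \<alpha> \<beta> lam)"
  shows "Phi M Y lam t
    = a * theta_plus \<alpha> \<beta> lam ^ t + (Phi M Y lam 0 - a) * theta_minus \<alpha> \<beta> lam ^ t"
proof (rule second_order_recurrence_solution)
  show "Phi M Y lam (Suc (Suc n)) = (theta_plus \<alpha> \<beta> lam + theta_minus \<alpha> \<beta> lam) * Phi M Y lam (Suc n)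
      - theta_plus \<alpha> \<beta> lam * theta_minus \<alpha> \<beta> lam * Phi M Y lam n" for n
    using Phi_recurrence[OF mc lam] D by (simp add: theta_sum theta_prod)
  show "theta_plus \<alpha> \<beta> lam \<noteq> theta_minus \<alpha> \<beta> lam"
    using D theta_diff[of \<alpha> \<beta> lam] by auto
qed (simp add: a theta_diff)

lemma Phi_deterministic_start:
  assumes mc: "markov_chain M S p Y" and S: "finite S" and lam: "lam \<noteq> 0"
    and start: "AE \<omega> in M. Y 0 \<omega> = c"
  shows "Phi M Y lam 0 = lam powi c"
    and "Phi M Y lam 1 = lam powi c * tilted_op p S lam (\<lambda>_. 1) c"
proof -
  interpret prob_space M using mc by (simp add: markov_chain_def)
  have const: "(\<integral>\<omega>. lam powi partial_sum Y 0 \<omega> * g (Y 0 \<omega>) \<partial>M) = lam powi c * g c"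
    for g :: "int \<Rightarrow> real"
  proof -
    have "(\<integral>\<omega>. lam powi partial_sum Y 0 \<omega> * g (Y 0 \<omega>) \<partial>M) = (\<integral>\<omega>. lam powi c * g c \<partial>M)"
      by (rule integral_cong_AE)
         (use start borel_measurable_integrable[OF integrable_tilted[OF mc S, of lam 0 g]]
          in \<open>auto simp: partial_sum_def\<close>)
    then show ?thesis by (simp add: prob_space)
  qed
  show "Phi M Y lam 0 = lam powi c"
    using const[of "\<lambda>_. 1"] by (simp add: Phi_def)
  show "Phi M Y lam 1 = lam powi c * tilted_op p S lam (\<lambda>_. 1) c"
    using const Phi_eq_tilted[OF mc S lam, of 0] by simp
qed

theorem proposition6p4:
  fixes \<alpha> \<beta> lam :: real and t :: nat
    and M :: "'a measure" and Y :: "nat \<Rightarrow> 'a \<Rightarrow> int"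
  assumes "0 < \<alpha>" "\<alpha> < 1" "0 < \<beta>" "\<beta> < 1"
    and "markov_chain M {-1, 1} (two_state_matrix \<alpha> \<beta>) Y"
    and "lam > 0"
  shows
    "((AE \<omega> in M. Y 0 \<omega> = -1) \<longrightarrow>
       (let a_plus = (1 - \<alpha> + lam * (lam * \<alpha> - theta_minus \<alpha> \<beta> lam)) / (lam\<^sup>2 * sqrt (discr \<alpha> \<beta> lam));
            a_minus = 1 / lam - a_plus
        in Phi M Y lam t = a_plus * theta_plus \<alpha> \<beta> lam ^ t + a_minus * theta_minus \<alpha> \<beta> lam ^ t)) \<and>
     ((AE \<omega> in M. Y 0 \<omega> = 1) \<longrightarrow>
       (let a_plus = ((1 - \<beta>) * lam\<^sup>2 + \<beta> - lam * theta_minus \<alpha> \<beta> lam) / sqrt (discr \<alpha> \<beta> lam);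
            a_minus = lam - a_plus
        in Phi M Y lam t = a_plus * theta_plus \<alpha> \<beta> lam ^ t + a_minus * theta_minus \<alpha> \<beta> lam ^ t))"
proof -
  note mc = \<open>markov_chain M {-1, 1} (two_state_matrix \<alpha> \<beta>) Y\<close>
  have lam: "lam \<noteq> 0" using \<open>lam > 0\<close> by simp
  have D: "discr \<alpha> \<beta> lam > 0" using assms by (intro discr_pos)
  have fin: "finite {-1, 1 :: int}" by simp
  note start = Phi_deterministic_start[OF mc fin lam, unfolded tilted_op_two_state]
  note closed = Phi_closed_form[OF mc lam D refl, of t]
  let ?D = "sqrt (discr \<alpha> \<beta> lam)" and ?\<theta> = "theta_minus \<alpha> \<beta> lam"
  have minus: "Phi M Y lam 0 = 1 / lam"
      "(Phi M Y lam 1 - ?\<theta> * Phi M Y lam 0) / ?D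
        = (1 - \<alpha> + lam * (lam * \<alpha> - ?\<theta>)) / (lam\<^sup>2 * ?D)"
    if ae: "AE \<omega> in M. Y 0 \<omega> = -1"
  proof -
    show Phi0: "Phi M Y lam 0 = 1 / lam"
      using start(1)[OF ae] by (simp add: power_int_minus divide_inverse)
    have "Phi M Y lam 1 = (1 - \<alpha>) / lam\<^sup>2 + \<alpha>"
      using lam by (subst start(2)[OF ae]) (simp add: power_int_minus field_simps power2_eq_square)
    then have "Phi M Y lam 1 - ?\<theta> * Phi M Y lam 0 = (1 - \<alpha> + lam * (lam * \<alpha> - ?\<theta>)) / lam\<^sup>2"
      using lam by (simp add: Phi0 field_simps power2_eq_square)
    then show "(Phi M Y lam 1 - ?\<theta> * Phi M Y lam 0) / ?D
        = (1 - \<alpha> + lam * (lam * \<alpha> - ?\<theta>)) / (lam\<^sup>2 * ?D)"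
      by simp
  qed
  have plus: "Phi M Y lam 0 = lam"
      "(Phi M Y lam 1 - ?\<theta> * Phi M Y lam 0) / ?D = ((1 - \<beta>) * lam\<^sup>2 + \<beta> - lam * ?\<theta>) / ?D"
    if ae: "AE \<omega> in M. Y 0 \<omega> = 1"
  proof -
    show Phi0: "Phi M Y lam 0 = lam"
      using start(1)[OF ae] by simp
    have "Phi M Y lam 1 = (1 - \<beta>) * lam\<^sup>2 + \<beta>"
      using lam by (subst start(2)[OF ae]) (simp add: field_simps power2_eq_square)
    then show "(Phi M Y lam 1 - ?\<theta> * Phi M Y lam 0) / ?D = ((1 - \<beta>) * lam\<^sup>2 + \<beta> - lam * ?\<theta>) / ?D"
      using Phi0 by (simp add: mult.commute)
  qed
  show ?thesis
    unfolding Let_def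
  proof (intro conjI impI)
    assume ae: "AE \<omega> in M. Y 0 \<omega> = -1"
    show "Phi M Y lam t = (1 - \<alpha> + lam * (lam * \<alpha> - ?\<theta>)) / (lam\<^sup>2 * ?D) * theta_plus \<alpha> \<beta> lam ^ t
        + (1 / lam - (1 - \<alpha> + lam * (lam * \<alpha> - ?\<theta>)) / (lam\<^sup>2 * ?D)) * ?\<theta> ^ t"
      using closed unfolding minus(2)[OF ae] unfolding minus(1)[OF ae] .
  next
    assume ae: "AE \<omega> in M. Y 0 \<omega> = 1"
    show "Phi M Y lam t = ((1 - \<beta>) * lam\<^sup>2 + \<beta> - lam * ?\<theta>) / ?D * theta_plus \<alpha> \<beta> lam ^ t
        + (lam - ((1 - \<beta>) * lam\<^sup>2 + \<beta> - lam * ?\<theta>) / ?D) * ?\<theta> ^ t"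
      using closed unfolding plus(2)[OF ae] unfolding plus(1)[OF ae] .
  qed
qed

end
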